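(* Let $K$ be a set with $|K|\geq 2$, let $\mathbb{P}^K$ be the semigroup of all functions $K\to\mathbb{P}$ under point-wise addition, and let $\mathcal{A}$ be the set of all atoms of $\mathbb{P}^K$. Let $X=\{x_{\mathbf a}:\mathbf a\in\mathcal{A}\}$ be an abstract alphabet in one-one correspondence with $\mathcal{A}$, and let $\phi:X^+\to\mathbb{P}^K$ be the semigroup homomorphism determined by $x_{\mathbf a}\mapsto\mathbf a$ for $\mathbf a\in\mathcal A$. Let $R\subseteq X^+\times X^+$ be the set of all relations of the form $$x_{\mathbf a}x_{\mathbf b}=x_{\mathbf 1}^m x_{\mathbf c}\qquad\text{for } \mathbf a,\mathbf b\in\mathcal{A},\text{ where } m=\mu(\mathbf a+\mathbf b)-1 \text{ and } \mathbf c=\mathbf a+\mathbf b-m\mathbf 1.$$ Then the semigroup $\mathbb{P}^K$ has presentation $\langle X:R\rangle$ via $\phi$; that is, $\phi$ is surjective and $\ker\phi=R^\sharp$.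
   Context: $\mathbb{P}=\{1,2,3,\ldots\}$ is the additive semigroup of positive integers. A function $K\to\mathbb{P}$ is written as a tuple $\mathbf a=(a_k)_{k\in K}$, and $\mathbf 1=(1)_{k\in K}$ is the constant tuple with all entries $1$. An element $\mathbf a\in\mathbb{P}^K$ is an atom if there do not exist $\mathbf b,\mathbf c\in\mathbb{P}^K$ with $\mathbf a=\mathbf b+\mathbf c$. The function $\mu:\mathbb{P}^K\to\mathbb{P}$ is $\mu(\mathbf a)=\min_{k\in K}a_k$. (For $\mathbf a,\mathbf b\in\mathcal A$ and $m,\mathbf c$ as in the relations, one has $m\geq 1$ and $\mathbf c\in\mathcal A$, and $\mathbf 1\in\mathcal A$, so $x_{\mathbf 1}^m x_{\mathbf c}$ is a word over $X$.) The free semigroup $X^+$ consists of all non-empty words over $X$ under concatenation. A pair $(u,v)\in R$ is displayed as an equation $u=v$, and $R^\sharp$ denotes the congruence on $X^+$ generated by $R$. The kernel of a homomorphism $\phi$ on $X^+$ is $\ker\phi=\{(u,v)\in X^+\times X^+:\phi(u)=\phi(v)\}$. A semigroup $S$ has presentation $\langle X:R\rangle$ via $\phi$ if $\phi:X^+\to S$ is a surjective homomorphism with kernel $R^\sharp$. *)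

theory Defs
  imports Main "HOL-Library.FuncSet"
begin

text \<open>
  The library has no carrier-based semigroups (the records of HOL-Algebra include a unit), so a
  semigroup is given here by a carrier \<open>S\<close> and an operation \<open>f\<close>.
\<close>

definition semigroup_on :: "'a set \<Rightarrow> ('a \<Rightarrow> 'a \<Rightarrow> 'a) \<Rightarrow> bool" where
  "semigroup_on S f \<longleftrightarrow>
     (\<forall>a\<in>S. \<forall>b\<in>S. f a b \<in> S) \<and>
     (\<forall>a\<in>S. \<forall>b\<in>S. \<forall>c\<in>S. f (f a b) c = f a (f b c))"

definition semigroup_hom_on ::
    "'a set \<Rightarrow> ('a \<Rightarrow> 'a \<Rightarrow> 'a) \<Rightarrow> 'b set \<Rightarrow> ('b \<Rightarrow> 'b \<Rightarrow> 'b) \<Rightarrow> ('a \<Rightarrow> 'b) \<Rightarrow> bool" where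
  "semigroup_hom_on S f T g \<phi> \<longleftrightarrow>
     \<phi> \<in> S \<rightarrow> T \<and> (\<forall>a\<in>S. \<forall>b\<in>S. \<phi> (f a b) = g (\<phi> a) (\<phi> b))"

definition kernel_on :: "'a set \<Rightarrow> ('a \<Rightarrow> 'b) \<Rightarrow> ('a \<times> 'a) set" where
  "kernel_on S \<phi> = {(u, v). u \<in> S \<and> v \<in> S \<and> \<phi> u = \<phi> v}"

definition congruence_on :: "'a set \<Rightarrow> ('a \<Rightarrow> 'a \<Rightarrow> 'a) \<Rightarrow> ('a \<times> 'a) set \<Rightarrow> bool" where
  "congruence_on S f \<rho> \<longleftrightarrow>
     equiv S \<rho> \<and> (\<forall>(a, b)\<in>\<rho>. \<forall>c\<in>S. (f a c, f b c) \<in> \<rho> \<and> (f c a, f c b) \<in> \<rho>)"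

definition generated_congruence ::
    "'a set \<Rightarrow> ('a \<Rightarrow> 'a \<Rightarrow> 'a) \<Rightarrow> ('a \<times> 'a) set \<Rightarrow> ('a \<times> 'a) set" where
  "generated_congruence S f R = \<Inter>{\<rho>. congruence_on S f \<rho> \<and> R \<subseteq> \<rho>}"

text \<open>The free semigroup over the alphabet \<open>X\<close>; its operation is \<open>(@)\<close>.\<close>

definition free_semigroup :: "'x set \<Rightarrow> 'x list set" where
  "free_semigroup X = {w. w \<noteq> [] \<and> set w \<subseteq> X}"

text \<open>
  The homomorphism on the free semigroup determined by the images \<open>h y\<close> of the letters \<open>y\<close>.
  The empty word does not belong to the free semigroup, so its value is irrelevant.
\<close>

fun free_extension :: "('a \<Rightarrow> 'a \<Rightarrow> 'a) \<Rightarrow> ('x \<Rightarrow> 'a) \<Rightarrow> 'x list \<Rightarrow> 'a" where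
  "free_extension f h [] = undefined"
| "free_extension f h [y] = h y"
| "free_extension f h (y # z # w) = f (h y) (free_extension f h (z # w))"

definition has_presentation_via ::
    "'a set \<Rightarrow> ('a \<Rightarrow> 'a \<Rightarrow> 'a) \<Rightarrow> 'x set \<Rightarrow> ('x list \<times> 'x list) set \<Rightarrow> ('x list \<Rightarrow> 'a) \<Rightarrow> bool" where
  "has_presentation_via S f X R \<phi> \<longleftrightarrow>
     semigroup_on S f \<and>
     R \<subseteq> free_semigroup X \<times> free_semigroup X \<and>
     semigroup_hom_on (free_semigroup X) (@) S f \<phi> \<and>
     \<phi> ` free_semigroup X = S \<and>
     kernel_on (free_semigroup X) \<phi> = generated_congruence (free_semigroup X) (@) R"

text \<open>
  Functions from \<open>K\<close> to the positive integers, as extensional functions (value \<open>undefined\<close>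
  outside \<open>K\<close>), so that equality is equality on \<open>K\<close>.
\<close>

definition pos_fun :: "'k set \<Rightarrow> ('k \<Rightarrow> nat) set" where
  "pos_fun K = K \<rightarrow>\<^sub>E {1..}"

definition pos_add :: "'k set \<Rightarrow> ('k \<Rightarrow> nat) \<Rightarrow> ('k \<Rightarrow> nat) \<Rightarrow> ('k \<Rightarrow> nat)" where
  "pos_add K a b = (\<lambda>k\<in>K. a k + b k)"

definition pos_one :: "'k set \<Rightarrow> ('k \<Rightarrow> nat)" where
  "pos_one K = (\<lambda>k\<in>K. 1)"

definition atoms :: "'k set \<Rightarrow> ('k \<Rightarrow> nat) set" where
  "atoms K = {a \<in> pos_fun K. \<not> (\<exists>b\<in>pos_fun K. \<exists>c\<in>pos_fun K. a = pos_add K b c)}"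

text \<open>
  On a nonempty set of natural numbers, finite or not, \<open>Inf\<close> is the least element, whereas \<open>Min\<close>
  would be unspecified on an infinite range.
\<close>

definition mu :: "'k set \<Rightarrow> ('k \<Rightarrow> nat) \<Rightarrow> nat" where
  "mu K a = (INF k\<in>K. a k)"

text \<open>
  The letter corresponding to the atom \<open>a\<close> is \<open>x a\<close>. The truncated subtractions never truncate:
  every value of \<open>a + b\<close> is at least 2, and \<open>m\<close> is smaller than each of them.
\<close>

definition atom_relations ::
    "'k set \<Rightarrow> (('k \<Rightarrow> nat) \<Rightarrow> 'x) \<Rightarrow> ('x list \<times> 'x list) set" where
  "atom_relations K x =
     {([x a, x b], replicate m (x (pos_one K)) @ [x c]) | a b m c.
        a \<in> atoms K \<and> b \<in> atoms K \<and>
        m = mu K (pos_add K a b) - 1 \<and>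
        c = (\<lambda>k\<in>K. pos_add K a b k - m * pos_one K k)}"

end

(* The atoms are the functions that attain the value 1. Since a + 1 has minimum 2, the relation for
   the pair (a, 1) says that the letter of 1 commutes with every letter, so the relations bring
   every word to the form 1^m c with c an atom. Such a word is determined by its value,
   because c attains 1 and hence m + 1 is the minimum of the value. *)

theory Submission
  imports Defs
begin

section \<open>Atoms and minima of positive functions\<close>

lemma atoms_iff:
  "a \<in> atoms K \<longleftrightarrow> a \<in> pos_fun K \<and> (\<exists>k\<in>K. a k = 1)"
proof -
  have "(\<exists>b\<in>pos_fun K. \<exists>c\<in>pos_fun K. a = pos_add K b c) \<longleftrightarrow> \<not> (\<exists>k\<in>K. a k = 1)"
    if a: "a \<in> pos_fun K"
  proof
    assume "\<exists>b\<in>pos_fun K. \<exists>c\<in>pos_fun K. a = pos_add K b c"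
    then obtain b c where "b \<in> pos_fun K" "c \<in> pos_fun K" "a = pos_add K b c"
      by blast
    then have "b k \<ge> 1 \<and> c k \<ge> 1 \<and> a k = b k + c k" if "k \<in> K" for k
      using that by (auto simp: pos_fun_def pos_add_def)
    then show "\<not> (\<exists>k\<in>K. a k = 1)"
      by force
  next
    assume ne: "\<not> (\<exists>k\<in>K. a k = 1)"
    have ge: "a k \<ge> 2" if "k \<in> K" for k
    proof -
      have "a k \<ge> 1"
        using a that by (auto simp: pos_fun_def)
      moreover have "a k \<noteq> 1"
        using ne that by blast
      ultimately show ?thesis
        by linarith
    qed
    \<comment> \<open>If \<open>a\<close> never takes the value 1, then
      \<open>a = (a - 1) + 1\<close> is a decomposition: \<open>ge\<close> keeps
      \<open>a - 1\<close> positive and makes the truncated subtraction exact.\<close>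
    have "(\<lambda>k\<in>K. a k - 1) \<in> pos_fun K"
      using ge by (force simp: pos_fun_def)
    moreover have "pos_one K \<in> pos_fun K"
      by (auto simp: pos_fun_def pos_one_def)
    moreover have "a = pos_add K (\<lambda>k\<in>K. a k - 1) (pos_one K)"
    proof (rule extensionalityI[of _ K])
      show "a \<in> extensional K"
        using a by (simp add: pos_fun_def PiE_def)
      show "a k = pos_add K (\<lambda>k\<in>K. a k - 1) (pos_one K) k" if "k \<in> K" for k
        using ge[OF that] that by (simp add: pos_add_def pos_one_def)
    qed (simp add: pos_add_def)
    ultimately show "\<exists>b\<in>pos_fun K. \<exists>c\<in>pos_fun K. a = pos_add K b c"
      by blast
  qed
  then show ?thesis
    by (auto simp: atoms_def)
qed

lemma pos_one_in_atoms: "K \<noteq> {} \<Longrightarrow> pos_one K \<in> atoms K"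
  by (auto simp: atoms_iff pos_fun_def pos_one_def)

lemma mu_le: "k \<in> K \<Longrightarrow> mu K a \<le> a k"
  unfolding mu_def by (rule cINF_lower) simp_all

text \<open>The well-ordering of the naturals gives a minimizer even when \<open>K\<close> is
  infinite and \<open>a\<close> has infinite range.\<close>

lemma mu_attained: "K \<noteq> {} \<Longrightarrow> \<exists>k\<in>K. a k = mu K a"
  using Inf_nat_def1[of "a ` K"] unfolding mu_def by fastforce

lemma pos_fun_eqI:
  assumes "a \<in> pos_fun K" "b \<in> pos_fun K" "\<And>k. k \<in> K \<Longrightarrow> a k = b k"
  shows "a = b"
  using assms unfolding pos_fun_def by (rule PiE_ext)

lemma pos_fun_ge: "a \<in> pos_fun K \<Longrightarrow> k \<in> K \<Longrightarrow> a k \<ge> 1"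
  by (auto simp: pos_fun_def)

text \<open>Subtracting \<open>mu K a - 1\<close> lowers the minimum to exactly 1, and the minimum
  is attained. This makes the last letter of a normal form legitimate.\<close>

lemma normal_form_remainder_in_atoms:
  assumes "K \<noteq> {}" and "a \<in> pos_fun K" and m: "m = mu K a - 1"
  shows "(\<lambda>k\<in>K. a k - m) \<in> atoms K"
proof -
  obtain j where j: "j \<in> K" "a j = mu K a"
    using mu_attained[OF assms(1)] by blast
  have "mu K a \<ge> 1"
    using pos_fun_ge[OF assms(2) j(1)] j(2) by simp
  then have "a k - m \<ge> 1" if "k \<in> K" for k
    using mu_le[OF that, of a] m by linarith
  moreover have "a j - m = 1"
    using j \<open>mu K a \<ge> 1\<close> m by linarith
  ultimately show ?thesis
    using j(1) by (auto simp: atoms_iff pos_fun_def)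
qed

lemma pos_add_in_pos_fun:
  "a \<in> pos_fun K \<Longrightarrow> b \<in> pos_fun K \<Longrightarrow> pos_add K a b \<in> pos_fun K"
  by (auto simp: pos_fun_def pos_add_def PiE_iff trans_le_add1)

lemma pos_add_assoc: "pos_add K (pos_add K a b) c = pos_add K a (pos_add K b c)"
  by (auto simp: pos_add_def)

section \<open>Words over an alphabet and congruences on them\<close>

lemma free_extension_in_carrier:
  assumes "semigroup_on S f" "h \<in> X \<rightarrow> S" "w \<in> free_semigroup X"
  shows "free_extension f h w \<in> S"
  using assms
  by (induction f h w rule: free_extension.induct)
    (auto simp: free_semigroup_def semigroup_on_def Pi_iff)

lemma free_extension_append:
  assumes "semigroup_on S f" "h \<in> X \<rightarrow> S" "u \<in> free_semigroup X" "v \<in> free_semigroup X"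
  shows "free_extension f h (u @ v) = f (free_extension f h u) (free_extension f h v)"
  using assms
proof (induction f h u rule: free_extension.induct)
  case (2 f h y)
  then show ?case
    by (cases v) (auto simp: free_semigroup_def)
next
  case (3 f h y z w)
  have zw: "z # w \<in> free_semigroup X" and y: "h y \<in> S"
    using 3 by (auto simp: free_semigroup_def)
  note 3(1)[OF 3(2,3) zw 3(5)]
  \<comment> \<open>The product over a word is nested to the right, so associativity has to move the
    bracket past the first letter.\<close>
  moreover have "f (f (h y) (free_extension f h (z # w))) (free_extension f h v) =
      f (h y) (f (free_extension f h (z # w)) (free_extension f h v))"
    using 3(2) y free_extension_in_carrier[OF 3(2,3) zw]
      free_extension_in_carrier[OF 3(2,3) 3(5)]
    unfolding semigroup_on_def by blast
  ultimately show ?case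
    by simp
qed (simp add: free_semigroup_def)

lemma congruence_on_kernel:
  assumes "semigroup_on S f" "semigroup_hom_on S f T g \<phi>"
  shows "congruence_on S f (kernel_on S \<phi>)"
  using assms
  by (auto simp: congruence_on_def kernel_on_def semigroup_on_def semigroup_hom_on_def
      equiv_def refl_on_def sym_def trans_def)

text \<open>This permits cutting an arbitrary congruence that contains the relations down to one
  inside the kernel.\<close>

lemma congruence_on_Int:
  "congruence_on S f \<rho> \<Longrightarrow> congruence_on S f \<sigma> \<Longrightarrow> congruence_on S f (\<rho> \<inter> \<sigma>)"
  unfolding congruence_on_def equiv_def refl_on_def sym_def trans_def by fast

lemma semigroup_on_free_semigroup: "semigroup_on (free_semigroup X) (@)"
  by (auto simp: semigroup_on_def free_semigroup_def)

text \<open>Compatibility is only given for non-empty factors. The empty \<open>w\<close> is allowed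
  here because powers of the letter of 1 may have exponent 0.\<close>

lemma congruence_on_prepend:
  assumes "congruence_on (free_semigroup X) (@) \<rho>" "(u, v) \<in> \<rho>" "set w \<subseteq> X"
  shows "(w @ u, w @ v) \<in> \<rho>"
  using assms by (cases "w = []") (auto simp: congruence_on_def free_semigroup_def)

lemma congruence_on_append:
  assumes "congruence_on (free_semigroup X) (@) \<rho>" "(u, v) \<in> \<rho>" "set w \<subseteq> X"
  shows "(u @ w, v @ w) \<in> \<rho>"
  using assms by (cases "w = []") (auto simp: congruence_on_def free_semigroup_def)

lemma congruence_on_refl: "congruence_on S f \<rho> \<Longrightarrow> u \<in> S \<Longrightarrow> (u, u) \<in> \<rho>"
  by (auto simp: congruence_on_def equiv_def refl_on_def)

lemma congruence_on_sym: "congruence_on S f \<rho> \<Longrightarrow> (u, v) \<in> \<rho> \<Longrightarrow> (v, u) \<in> \<rho>"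
  by (auto simp: congruence_on_def equiv_def dest: symD)

lemma congruence_on_trans:
  "congruence_on S f \<rho> \<Longrightarrow> (u, v) \<in> \<rho> \<Longrightarrow> (v, w) \<in> \<rho> \<Longrightarrow> (u, w) \<in> \<rho>"
  by (auto simp: congruence_on_def equiv_def dest: transD)

section \<open>Values of words and normal forms\<close>

locale atom_alphabet =
  fixes K :: "'k set" and X :: "'x set" and x :: "('k \<Rightarrow> nat) \<Rightarrow> 'x"
  assumes nonempty: "K \<noteq> {}" and bij: "bij_betw x (atoms K) X"
begin

abbreviation letter_value where "letter_value \<equiv> the_inv_into (atoms K) x"
abbreviation word_value where "word_value \<equiv> free_extension (pos_add K) letter_value"
abbreviation normal_form where "normal_form m c \<equiv> replicate m (x (pos_one K)) @ [x c]"

lemma letter_value_letter: "a \<in> atoms K \<Longrightarrow> letter_value (x a) = a"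
  using bij by (simp add: bij_betw_def the_inv_into_f_f)

lemma letter_in_alphabet: "a \<in> atoms K \<Longrightarrow> x a \<in> X"
  using bij by (auto simp: bij_betw_def)

lemma letter_value_in_pos_fun: "letter_value \<in> X \<rightarrow> pos_fun K"
proof
  fix y assume "y \<in> X"
  then obtain a where "a \<in> atoms K" "y = x a"
    using bij by (auto simp: bij_betw_def)
  then show "letter_value y \<in> pos_fun K"
    by (simp add: letter_value_letter atoms_iff)
qed

lemma semigroup_on_pos_fun: "semigroup_on (pos_fun K) (pos_add K)"
  by (simp add: semigroup_on_def pos_add_in_pos_fun pos_add_assoc)

lemma word_value_in_pos_fun: "w \<in> free_semigroup X \<Longrightarrow> word_value w \<in> pos_fun K"
  by (rule free_extension_in_carrier[OF semigroup_on_pos_fun letter_value_in_pos_fun])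

lemma semigroup_hom_on_word_value:
  "semigroup_hom_on (free_semigroup X) (@) (pos_fun K) (pos_add K) word_value"
  using free_extension_append[OF semigroup_on_pos_fun letter_value_in_pos_fun]
  by (auto simp: semigroup_hom_on_def word_value_in_pos_fun)

lemma normal_form_in_free_semigroup:
  "c \<in> atoms K \<Longrightarrow> normal_form m c \<in> free_semigroup X"
  using letter_in_alphabet pos_one_in_atoms[OF nonempty] by (auto simp: free_semigroup_def)

lemma word_value_normal_form:
  assumes "c \<in> atoms K" "k \<in> K"
  shows "word_value (normal_form m c) k = m + c k"
proof (induction m)
  case 0
  show ?case
    using assms by (simp add: letter_value_letter)
next
  case (Suc m)
  have "normal_form (Suc m) c = [x (pos_one K)] @ normal_form m c"
    by simp
  \<comment> \<open>The first letter is the normal form of \<open>pos_one K\<close> with exponent 0,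
    which places it in the free semigroup so that the homomorphism law applies.\<close>
  also have "word_value \<dots> k = pos_add K (word_value [x (pos_one K)]) (word_value (normal_form m c)) k"
    using semigroup_hom_on_word_value normal_form_in_free_semigroup[OF assms(1), of m]
      normal_form_in_free_semigroup[OF pos_one_in_atoms[OF nonempty], of 0]
    unfolding semigroup_hom_on_def by auto
  also have "\<dots> = word_value [x (pos_one K)] k + word_value (normal_form m c) k"
    using assms(2) by (simp only: pos_add_def restrict_apply')
  also have "\<dots> = 1 + (m + c k)"
  proof -
    have "word_value [x (pos_one K)] k = 1"
      using letter_value_letter[OF pos_one_in_atoms[OF nonempty]] assms(2)
      by (simp add: pos_one_def)
    then show ?thesis
      using Suc by simp
  qed
  finally show ?case
    by simp
qed

text \<open>Where \<open>c\<close> is 1, the common value is \<open>m + 1\<close> and also at least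
  \<open>n + 1\<close>. A point where \<open>d\<close> is 1 gives the reverse inequality, and
  cancelling \<open>m = n\<close> leaves \<open>c = d\<close>.\<close>

lemma word_value_normal_form_inject:
  assumes c: "c \<in> atoms K" and d: "d \<in> atoms K"
    and eq: "word_value (normal_form m c) = word_value (normal_form n d)"
  shows "m = n \<and> c = d"
proof -
  have sums: "m + c k = n + d k" if "k \<in> K" for k
    using word_value_normal_form[OF c that, of m] word_value_normal_form[OF d that, of n] eq
    by simp
  obtain i j where ij: "i \<in> K" "c i = 1" "j \<in> K" "d j = 1"
    using c d by (auto simp: atoms_iff)
  moreover have "d i \<ge> 1" "c j \<ge> 1"
    using ij c d pos_fun_ge[of d K i] pos_fun_ge[of c K j] by (auto simp: atoms_iff)
  ultimately have "m = n"
    using sums[of i] sums[of j] by linarith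
  then show ?thesis
    using sums c d by (auto simp: atoms_iff intro!: pos_fun_eqI[of c K d])
qed

lemma atom_relations_eq:
  "atom_relations K x =
     {([x a, x b], normal_form m c) | a b m c.
        a \<in> atoms K \<and> b \<in> atoms K \<and> m = mu K (pos_add K a b) - 1 \<and>
        c = (\<lambda>k\<in>K. pos_add K a b k - m)}"
proof -
  have "(\<lambda>k\<in>K. f k - m * pos_one K k) = (\<lambda>k\<in>K. f k - m)" for f m
    by (auto simp: pos_one_def)
  then show ?thesis
    by (simp add: atom_relations_def)
qed

text \<open>An explicit preimage of \<open>a\<close>. It serves both surjectivity and, applied to a
  sum of two atoms, the soundness of the relations.\<close>

lemma word_value_normal_form_mu:
  assumes "a \<in> pos_fun K" "m = mu K a - 1"
  shows "word_value (normal_form m (\<lambda>k\<in>K. a k - m)) = a"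
proof (rule pos_fun_eqI[of _ K])
  have c: "(\<lambda>k\<in>K. a k - m) \<in> atoms K"
    using normal_form_remainder_in_atoms[OF nonempty assms] .
  then show "word_value (normal_form m (\<lambda>k\<in>K. a k - m)) \<in> pos_fun K"
    by (intro word_value_in_pos_fun normal_form_in_free_semigroup)
  \<comment> \<open>Adding \<open>m\<close> back undoes the subtraction because \<open>m\<close> is
    at most \<open>mu K a\<close>, hence at most \<open>a k\<close>.\<close>
  show "word_value (normal_form m (\<lambda>k\<in>K. a k - m)) k = a k" if "k \<in> K" for k
    using word_value_normal_form[OF c that, of m] mu_le[OF that, of a] assms(2) that by simp
qed (rule assms)

lemma surj_word_value: "word_value ` free_semigroup X = pos_fun K"
proof
  show "pos_fun K \<subseteq> word_value ` free_semigroup X"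
  proof
    fix a assume a: "a \<in> pos_fun K"
    show "a \<in> word_value ` free_semigroup X"
      using word_value_normal_form_mu[OF a refl, symmetric]
        normal_form_in_free_semigroup[OF normal_form_remainder_in_atoms[OF nonempty a refl]]
      by (rule image_eqI)
  qed
qed (auto intro: word_value_in_pos_fun)

text \<open>The right side of each relation is the normal form of the value
  \<open>pos_add K a b\<close> of the left side.\<close>

lemma atom_relations_subset_kernel:
  "atom_relations K x \<subseteq> kernel_on (free_semigroup X) word_value"
proof
  fix r assume "r \<in> atom_relations K x"
  then obtain a b m where a: "a \<in> atoms K" and b: "b \<in> atoms K"
    and m: "m = mu K (pos_add K a b) - 1"
    and r: "r = ([x a, x b], normal_form m (\<lambda>k\<in>K. pos_add K a b k - m))"
    unfolding atom_relations_eq by blast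
  have ab: "pos_add K a b \<in> pos_fun K"
    using a b by (simp add: atoms_iff pos_add_in_pos_fun)
  have "word_value [x a, x b] = pos_add K a b"
    using a b by (simp add: letter_value_letter)
  moreover have "[x a, x b] \<in> free_semigroup X"
    using a b letter_in_alphabet by (auto simp: free_semigroup_def)
  ultimately show "r \<in> kernel_on (free_semigroup X) word_value"
    using word_value_normal_form_mu[OF ab m] r
      normal_form_in_free_semigroup[OF normal_form_remainder_in_atoms[OF nonempty ab m], of m]
    by (simp add: kernel_on_def)
qed

section \<open>Reduction to normal form modulo a congruence containing the relations\<close>

context
  fixes \<rho>
  assumes cong: "congruence_on (free_semigroup X) (@) \<rho>"
    and relations: "atom_relations K x \<subseteq> \<rho>"
begin

lemma one_commutes:
  assumes "a \<in> atoms K"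
  shows "([x a, x (pos_one K)], [x (pos_one K), x a]) \<in> \<rho>"
proof -
  let ?s = "pos_add K a (pos_one K)"
  obtain i where i: "i \<in> K" "a i = 1" and a: "a \<in> pos_fun K"
    using assms by (auto simp: atoms_iff)
  have val: "?s k = a k + 1" if "k \<in> K" for k
    using that by (simp add: pos_add_def pos_one_def)
  obtain j where "j \<in> K" "?s j = mu K ?s"
    using mu_attained[OF nonempty] by blast
  \<comment> \<open>All values of \<open>?s\<close> are at least 2, and 2 occurs at
    \<open>i\<close>, where the atom \<open>a\<close> is 1. So the relation for this pair has
    exponent 1 and remainder \<open>a\<close> itself.\<close>
  then have "mu K ?s \<ge> 2"
    using val pos_fun_ge[OF a] by fastforce
  moreover have "mu K ?s \<le> 2"
    using mu_le[OF i(1), of ?s] val i by simp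
  ultimately have m: "1 = mu K ?s - 1"
    by simp
  have c: "a = (\<lambda>k\<in>K. ?s k - 1)"
  proof (rule extensionalityI[of _ K])
    show "a \<in> extensional K"
      using a by (simp add: pos_fun_def PiE_def)
  qed (simp_all add: val)
  have "([x a, x (pos_one K)], normal_form 1 a) \<in> atom_relations K x"
    unfolding atom_relations_eq using assms pos_one_in_atoms[OF nonempty] m c by blast
  then show ?thesis
    using relations by auto
qed

text \<open>The letter of \<open>a\<close> passes one letter of 1 by \<open>one_commutes\<close>,
  and the remaining \<open>m\<close> of them by induction.\<close>

lemma power_one_commutes:
  assumes "a \<in> atoms K"
  shows "(x a # replicate m (x (pos_one K)), normal_form m a) \<in> \<rho>"
proof (induction m)
  case 0
  show ?case
    using congruence_on_refl[OF cong] normal_form_in_free_semigroup[OF assms, of 0] by simp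
next
  case (Suc m)
  let ?o = "x (pos_one K)"
  have o: "?o \<in> X"
    by (intro letter_in_alphabet pos_one_in_atoms nonempty)
  have "([x a, ?o] @ replicate m ?o, [?o, x a] @ replicate m ?o) \<in> \<rho>"
    using o by (intro congruence_on_append[OF cong one_commutes[OF assms]]) auto
  moreover have "([?o] @ (x a # replicate m ?o), [?o] @ normal_form m a) \<in> \<rho>"
    using o by (intro congruence_on_prepend[OF cong Suc]) simp
  ultimately show ?case
    using congruence_on_trans[OF cong] by fastforce
qed

text \<open>Induction on the word: a new first letter is moved past the power of 1 in the normal
  form of the tail. It then meets the final atom, and the relation for these two letters yields
  further letters of 1 and a single atom.\<close>

lemma word_related_normal_form:
  assumes "w \<in> free_semigroup X"
  shows "\<exists>m. \<exists>c\<in>atoms K. (w, normal_form m c) \<in> \<rho>"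
  using assms
proof (induction w)
  case (Cons y w)
  then obtain a where a: "a \<in> atoms K" and y: "y = x a"
    using bij by (auto simp: bij_betw_def free_semigroup_def)
  show ?case
  proof (cases "w = []")
    case True
    then have "(y # w, normal_form 0 a) \<in> \<rho>"
      using y congruence_on_refl[OF cong Cons.prems] by simp
    then show ?thesis
      using a by blast
  next
    case False
    then obtain m c where c: "c \<in> atoms K" and w: "(w, normal_form m c) \<in> \<rho>"
      using Cons by (auto simp: free_semigroup_def)
    let ?o = "x (pos_one K)"
    let ?s = "pos_add K a c"
    \<comment> \<open>\<open>n\<close> and \<open>d\<close> are the exponent and the remainder in
      the relation for the pair \<open>a\<close>, \<open>c\<close>.\<close>
    define n where "n = mu K ?s - 1"
    define d where "d = (\<lambda>k\<in>K. ?s k - n)"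
    have o: "?o \<in> X"
      by (intro letter_in_alphabet pos_one_in_atoms nonempty)
    have d: "d \<in> atoms K"
      unfolding d_def
      using a c by (intro normal_form_remainder_in_atoms nonempty n_def pos_add_in_pos_fun)
        (simp_all add: atoms_iff)
    have "([x a] @ w, [x a] @ normal_form m c) \<in> \<rho>"
      using letter_in_alphabet[OF a] by (intro congruence_on_prepend[OF cong w]) simp
    moreover have "((x a # replicate m ?o) @ [x c], normal_form m a @ [x c]) \<in> \<rho>"
      using letter_in_alphabet[OF c]
      by (intro congruence_on_append[OF cong power_one_commutes[OF a]]) simp
    ultimately have "(y # w, normal_form m a @ [x c]) \<in> \<rho>"
      using congruence_on_trans[OF cong] y by fastforce
    moreover have "([x a, x c], normal_form n d) \<in> \<rho>"
      using relations a c n_def d_def unfolding atom_relations_eq by blast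
    then have "(replicate m ?o @ [x a, x c], replicate m ?o @ normal_form n d) \<in> \<rho>"
      using o by (intro congruence_on_prepend[OF cong]) auto
    \<comment> \<open>The \<open>n\<close> new letters of 1 stand directly behind the old
      \<open>m\<close>, so the two powers merge.\<close>
    ultimately have "(y # w, normal_form (m + n) d) \<in> \<rho>"
      using congruence_on_trans[OF cong] by (fastforce simp: replicate_add)
    then show ?thesis
      using d by blast
  qed
qed (simp add: free_semigroup_def)

text \<open>Soundness carries the equality of values from \<open>u\<close> and \<open>v\<close> to
  their normal forms, which then coincide and link \<open>u\<close> to \<open>v\<close>.\<close>

lemma kernel_subset_sound_congruence:
  assumes sound: "\<rho> \<subseteq> kernel_on (free_semigroup X) word_value"
  shows "kernel_on (free_semigroup X) word_value \<subseteq> \<rho>"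
proof
  fix r assume "r \<in> kernel_on (free_semigroup X) word_value"
  then obtain u v where r: "r = (u, v)" and u: "u \<in> free_semigroup X"
    and v: "v \<in> free_semigroup X" and eq: "word_value u = word_value v"
    by (auto simp: kernel_on_def)
  obtain m c where c: "c \<in> atoms K" and uc: "(u, normal_form m c) \<in> \<rho>"
    using word_related_normal_form[OF u] by blast
  obtain n d where d: "d \<in> atoms K" and vd: "(v, normal_form n d) \<in> \<rho>"
    using word_related_normal_form[OF v] by blast
  have "word_value (normal_form m c) = word_value (normal_form n d)"
    using subsetD[OF sound uc] subsetD[OF sound vd] eq by (simp add: kernel_on_def)
  then have "m = n \<and> c = d"
    by (rule word_value_normal_form_inject[OF c d])
  then show "r \<in> \<rho>"
    using r congruence_on_trans[OF cong uc] congruence_on_sym[OF cong vd] by blast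
qed

end

section \<open>The kernel as the generated congruence\<close>

lemma congruence_on_kernel_word_value:
  "congruence_on (free_semigroup X) (@) (kernel_on (free_semigroup X) word_value)"
  using semigroup_on_free_semigroup semigroup_hom_on_word_value by (rule congruence_on_kernel)

lemma kernel_eq_generated_congruence:
  "kernel_on (free_semigroup X) word_value =
     generated_congruence (free_semigroup X) (@) (atom_relations K x)"
proof
  show "generated_congruence (free_semigroup X) (@) (atom_relations K x) \<subseteq>
      kernel_on (free_semigroup X) word_value"
    using congruence_on_kernel_word_value atom_relations_subset_kernel
    unfolding generated_congruence_def by blast
  \<comment> \<open>An arbitrary \<rho> may relate words of different values, so the previous
    argument is applied to its intersection with the kernel, which is sound and still contains the
    relations.\<close>
  have "kernel_on (free_semigroup X) word_value \<subseteq> \<rho>"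
    if "congruence_on (free_semigroup X) (@) \<rho>" "atom_relations K x \<subseteq> \<rho>" for \<rho>
    using kernel_subset_sound_congruence
        [OF congruence_on_Int[OF that(1) congruence_on_kernel_word_value]]
      that(2) atom_relations_subset_kernel by blast
  then show "kernel_on (free_semigroup X) word_value \<subseteq>
      generated_congruence (free_semigroup X) (@) (atom_relations K x)"
    unfolding generated_congruence_def by blast
qed

lemma has_presentation_via_word_value:
  "has_presentation_via (pos_fun K) (pos_add K) X (atom_relations K x) word_value"
  using semigroup_on_pos_fun atom_relations_subset_kernel semigroup_hom_on_word_value
    surj_word_value kernel_eq_generated_congruence
  unfolding has_presentation_via_def by (auto simp: kernel_on_def)

end

theorem theorem2p7:
  fixes K :: "'k set"
    and X :: "'x set"
    and x :: "('k \<Rightarrow> nat) \<Rightarrow> 'x"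
  assumes "infinite K \<or> card K \<ge> 2"
    and "bij_betw x (atoms K) X"
  shows "has_presentation_via (pos_fun K) (pos_add K) X (atom_relations K x)
           (free_extension (pos_add K) (the_inv_into (atoms K) x))"
proof -
  interpret atom_alphabet K X x
    using assms by unfold_locales auto
  show ?thesis
    by (rule has_presentation_via_word_value)
qed

end
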